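(* Let $m,n\ge 2$ be integers. Non-trivial $m\times n$ chessboards satisfying the neighbor-sum property exist if and only if $2\mid (m+1)$ and $3\mid (n+1)$.
   Context: An $m\times n$ chessboard is an assignment of an integer $x_{ij}\in\mathbb{Z}$ to each square $(i,j)$ with $1\le i\le m$, $1\le j\le n$. Two distinct squares $(i,j)\ne(i',j')$ are neighbors if $|i-i'|\le 1$ and $|j-j'|\le 1$ (they share an edge or a vertex). The chessboard satisfies the neighbor-sum property if the number on each square equals the sum of the numbers on all its neighboring squares. It is trivial if all its entries are $0$, and non-trivial otherwise.
   Formalization: The printed "only if" fails for m=2, n=3 (both rows 1,0,-1), so the condition is corrected to hold up to interchanging m and n: 2∣(m+1) and 3∣(n+1), or 2∣(n+1) and 3∣(m+1). *)

theory Defs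
  imports "HOL-Analysis.Analysis"
begin

definition squares :: "nat \<Rightarrow> nat \<Rightarrow> (nat \<times> nat) set" where
  "squares m n = {1..m} \<times> {1..n}"

text \<open>Coordinates are compared as integers, because subtraction on \<^typ>\<open>nat\<close> truncates.\<close>

definition neighbor :: "nat \<times> nat \<Rightarrow> nat \<times> nat \<Rightarrow> bool" where
  "neighbor s t \<longleftrightarrow> s \<noteq> t \<and> \<bar>int (fst s) - int (fst t)\<bar> \<le> 1 \<and> \<bar>int (snd s) - int (snd t)\<bar> \<le> 1"

text \<open>A chessboard is a total function of which only the values on \<^term>\<open>squares m n\<close> matter:
  neither predicate below looks at it anywhere else.\<close>

definition neighbor_sum_property :: "nat \<Rightarrow> nat \<Rightarrow> (nat \<times> nat \<Rightarrow> int) \<Rightarrow> bool" where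
  "neighbor_sum_property m n x \<longleftrightarrow>
     (\<forall>s\<in>squares m n. x s = (\<Sum>t\<in>{t \<in> squares m n. neighbor s t}. x t))"

definition trivial_board :: "nat \<Rightarrow> nat \<Rightarrow> (nat \<times> nat \<Rightarrow> int) \<Rightarrow> bool" where
  "trivial_board m n x \<longleftrightarrow> (\<forall>s\<in>squares m n. x s = 0)"

end

theory Submission
  imports Defs "HOL-Number_Theory.Cong"
begin

text \<open>
  Pairing a board with the sine eigenvectors of the path shows that a non-trivial \<open>m \<times> n\<close> board exists
  only if \<open>(1 + \<zeta> + 1/\<zeta>) (1 + \<eta> + 1/\<eta>) = 2\<close> for some \<open>\<zeta>\<close>, \<open>\<eta>\<close> with \<open>\<zeta>\<^bsup>2(m+1)\<^esup> = \<eta>\<^bsup>2(n+1)\<^esup> = 1\<close> and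
  \<open>\<zeta>\<^sup>2 \<noteq> 1 \<noteq> \<eta>\<^sup>2\<close>. This equation is studied 2-adically in the ring generated by roots of unity, in which 2
  is not a unit. As \<open>\<zeta> (\<zeta> - 1) (1 + \<zeta> + 1/\<zeta>) = \<zeta>\<^sup>3 - 1\<close>, the first factor is a unit unless
  \<open>3 dvd m + 1\<close>, so 3 divides \<open>m + 1\<close> or \<open>n + 1\<close>. If \<open>m + 1\<close> is odd and \<open>\<zeta>\<^sup>6 \<noteq> 1\<close>, then the first factor
  divides an odd integer, so 2 divides the second factor; this forces \<open>\<eta>\<^sup>6 = 1\<close>, because a root of unity
  congruent to 1 modulo 4 equals 1, and then \<open>\<zeta>\<^sup>2 = -1\<close>, which is absurd. Hence \<open>\<zeta>\<^sup>6 = 1\<close>, the factors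
  are 2 and 1, and \<open>\<eta>\<^sup>2 = -1\<close>.
\<close>

section \<open>The ring generated by roots of unity\<close>

text \<open>Adding one root at a time turns each closure property into an induction. For even
  \<open>K\<close>, -1 is itself a \<open>K\<close>-th root of unity, so these sums are closed under
  negation and form a ring.\<close>

inductive_set root_ring :: "nat \<Rightarrow> complex set" for K :: nat where
  zero: "0 \<in> root_ring K"
| add_root: "z \<in> root_ring K \<Longrightarrow> u ^ K = 1 \<Longrightarrow> z + u \<in> root_ring K"

lemma root_ring_root: "u ^ K = 1 \<Longrightarrow> u \<in> root_ring K"
  using root_ring.add_root[OF root_ring.zero, of u K] by simp

lemma root_ring_one: "1 \<in> root_ring K"
  by (rule root_ring_root) simp

lemma root_ring_add:
  assumes "w \<in> root_ring K" and "z \<in> root_ring K"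
  shows "z + w \<in> root_ring K"
  using assms by (induction rule: root_ring.induct) (auto simp: add.assoc[symmetric] intro: root_ring.intros)

lemma root_ring_times_root:
  assumes "z \<in> root_ring K" and "v ^ K = 1"
  shows "z * v \<in> root_ring K"
  using assms
  by (induction rule: root_ring.induct)
     (auto simp: distrib_right power_mult_distrib intro: root_ring.intros)

lemma root_ring_mult:
  assumes "w \<in> root_ring K" and "z \<in> root_ring K"
  shows "z * w \<in> root_ring K"
  using assms
  by (induction rule: root_ring.induct)
     (auto simp: distrib_left intro: root_ring.zero root_ring_add root_ring_times_root)

lemma root_ring_uminus:
  assumes "even K" and "z \<in> root_ring K"
  shows "- z \<in> root_ring K"
  using root_ring_times_root[OF assms(2), of "-1"] assms(1) by simp

lemma root_ring_diff:
  assumes "even K" and "z \<in> root_ring K" and "w \<in> root_ring K"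
  shows "z - w \<in> root_ring K"
  using root_ring_add[OF root_ring_uminus[OF assms(1,3)] assms(2)] by simp

lemma root_ring_power: "z \<in> root_ring K \<Longrightarrow> z ^ i \<in> root_ring K"
  by (induction i) (auto intro: root_ring_one root_ring_mult)

lemma root_ring_sum: "(\<And>i. i \<in> A \<Longrightarrow> f i \<in> root_ring K) \<Longrightarrow> sum f A \<in> root_ring K"
  by (induction A rule: infinite_finite_induct) (auto intro: root_ring.zero root_ring_add)

lemma root_ring_of_nat: "of_nat k \<in> root_ring K"
  by (induction k) (auto intro: root_ring.zero root_ring_one root_ring_add)

lemmas root_ring_intros =
  root_ring.zero root_ring_one root_ring_add root_ring_mult root_ring_power root_ring_sum
  root_ring_of_nat root_ring_diff

section \<open>Non-invertibility of 2 and its consequences\<close>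

lemma rational_functional_exists:
  obtains \<phi> :: "complex \<Rightarrow> rat"
  where "\<And>z w. \<phi> (z + w) = \<phi> z + \<phi> w" and "\<And>q z. \<phi> (of_rat q * z) = q * \<phi> z" and "\<phi> 1 = 1"
proof -
  interpret Q: vector_space "\<lambda>(q::rat) (z::complex). of_rat q * z"
    by unfold_locales (auto simp: algebra_simps of_rat_add of_rat_mult)
  have ind: "Q.independent {1}"
    by (simp add: Q.dependent_single)
  \<comment> \<open>The functional is the coordinate along 1 in a rational basis of the complex
    numbers that contains 1.\<close>
  define B where "B = Q.extend_basis {1}"
  have B: "Q.independent B" "Q.span B = UNIV" "1 \<in> B"
    unfolding B_def using Q.independent_extend_basis[OF ind] Q.span_extend_basis[OF ind]
      Q.extend_basis_superset[OF ind] by auto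
  show thesis
  proof (rule that[of "\<lambda>z. Q.representation B z 1"])
    show "Q.representation B (z + w) 1 = Q.representation B z 1 + Q.representation B w 1" for z w
      using Q.representation_add[OF B(1)] B(2) by auto
    show "Q.representation B (of_rat q * z) 1 = q * Q.representation B z 1" for q z
      using Q.representation_scale[OF B(1)] B(2) by auto
    show "Q.representation B 1 1 = 1"
      using Q.representation_basis[OF B(1) B(3)] by auto
  qed
qed

text \<open>A rational functional has bounded denominators on the finitely generated group
  \<^term>\<open>root_ring K\<close>, but not on the powers of 1/2.\<close>

lemma half_notin_root_ring:
  assumes "K > 0" and w: "w \<in> root_ring K"
  shows "2 * w \<noteq> 1"
proof
  assume half: "2 * w = 1"
  obtain \<phi> :: "complex \<Rightarrow> rat"
    where add: "\<And>z w. \<phi> (z + w) = \<phi> z + \<phi> w"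
      and scale: "\<And>q z. \<phi> (of_rat q * z) = q * \<phi> z" and one: "\<phi> 1 = 1"
    by (rule rational_functional_exists) blast
  define U where "U = {u::complex. u ^ K = 1}"
  have finU: "finite U"
    unfolding U_def using assms(1) by (intro finite_roots_unity) auto
  define den where "den q = snd (quotient_of q)" for q :: rat
  have den_pos: "den q > 0" for q
    unfolding den_def by (rule quotient_of_denom_pos')
  have den_Ints: "of_int (den q) * q \<in> \<int>" for q :: rat
  proof -
    obtain a b where ab: "quotient_of q = (a, b)" by (cases "quotient_of q")
    then have "b > 0" by (rule quotient_of_denom_pos)
    then show ?thesis using quotient_of_div[OF ab] ab by (simp add: den_def)
  qed
  define D where "D = (\<Prod>u\<in>U. den (\<phi> u))"
  have D_pos: "D > 0" unfolding D_def by (intro prod_pos) (simp add: den_pos)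
  have D_root: "of_int D * \<phi> u \<in> \<int>" if "u \<in> U" for u
  proof -
    have "D = (\<Prod>v\<in>U - {u}. den (\<phi> v)) * den (\<phi> u)"
      unfolding D_def by (simp add: prod.remove[OF finU that] mult.commute)
    then have "of_int D * \<phi> u = of_int (\<Prod>v\<in>U - {u}. den (\<phi> v)) * (of_int (den (\<phi> u)) * \<phi> u)"
      by (simp only: of_int_mult mult.assoc)
    then show ?thesis using den_Ints[of "\<phi> u"] by (metis Ints_mult Ints_of_int)
  qed
  have \<phi>0: "\<phi> 0 = 0" using add[of 0 0] by simp
  have D_Ints: "of_int D * \<phi> z \<in> \<int>" if "z \<in> root_ring K" for z
    using that
    by (induction rule: root_ring.induct) (auto simp: \<phi>0 add distrib_left D_root U_def)
  \<comment> \<open>\<open>w ^ k\<close> is the ring element 1/2^k, which makes \<open>2 ^ k\<close>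
    divide the common denominator \<open>D\<close>; this \<open>k\<close> is large enough that
    \<open>D < 2 ^ k\<close>.\<close>
  define k where "k = nat D"
  have "\<phi> (of_rat (2 ^ k) * w ^ k) = 2 ^ k * \<phi> (w ^ k)" by (rule scale)
  moreover have "of_rat (2 ^ k) * w ^ k = 1"
    using half by (simp add: of_rat_power power_mult_distrib[symmetric])
  ultimately have \<phi>k: "2 ^ k * \<phi> (w ^ k) = 1" using one by simp
  obtain c where c: "of_int D * \<phi> (w ^ k) = of_int c"
    using D_Ints[OF root_ring_power[OF w]] by (auto elim: Ints_cases)
  have "(of_int D :: rat) = of_int D * (2 ^ k * \<phi> (w ^ k))" using \<phi>k by simp
  also have "\<dots> = 2 ^ k * (of_int D * \<phi> (w ^ k))" by (simp only: mult_ac)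
  also have "\<dots> = of_int (2 ^ k * c)" using c by simp
  finally have "D = 2 ^ k * c" by (simp only: of_int_eq_iff)
  then have "2 ^ k dvd D" by simp
  then have "2 ^ k \<le> D" using D_pos by (intro zdvd_imp_le)
  moreover have "D < 2 ^ k"
    using of_nat_less_two_power[of k] D_pos by (simp add: k_def)
  ultimately show False by simp
qed

lemma odd_not_even_in_root_ring:
  assumes "K > 0" and "even K" and w: "w \<in> root_ring K" and "odd l"
  shows "2 * w \<noteq> of_nat l"
proof
  assume eq: "2 * w = of_nat l"
  obtain r where r: "l = 2 * r + 1" using \<open>odd l\<close> by (auto elim: oddE)
  have "w - of_nat r \<in> root_ring K" using assms by (intro root_ring_intros)
  then have "2 * (w - of_nat r) \<noteq> 1" by (rule half_notin_root_ring[OF assms(1)])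
  then show False using eq r by (simp add: algebra_simps)
qed

text \<open>In the odd case, the cofactor of \<open>4 c\<close> in \<open>(1 + 4 c)\<^bsup>l\<^esup> - 1\<close> is odd.\<close>

lemma root_of_unity_cong_1_mod_4:
  assumes K: "K > 0" "even K" and "c \<in> root_ring K" and "l > 0" and "(1 + 4 * c) ^ l = 1"
  shows "c = 0"
  using assms(3-)
proof (induction l arbitrary: c rule: less_induct)
  case (less l)
  note c = less.prems(1)
  show ?case
  proof (cases "even l")
    case True
    then obtain h where h: "l = 2 * h" by (auto elim: evenE)
    \<comment> \<open>Squaring preserves the form 1 + 4c', with c' = 2c + 4c^2, and halves the
      exponent.\<close>
    have "(1 + 4 * (of_nat 2 * c + of_nat 4 * c * c)) = (1 + 4 * c) ^ 2"
      by (simp add: power2_eq_square algebra_simps)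
    then have "(1 + 4 * (of_nat 2 * c + of_nat 4 * c * c)) ^ h = 1"
      using less.prems(3) by (simp only: h power_mult)
    moreover have "of_nat 2 * c + of_nat 4 * c * c \<in> root_ring K"
      by (intro root_ring_intros c)
    ultimately have "of_nat 2 * c + of_nat 4 * c * c = 0"
      using less.IH[of h] less.prems(2) h by auto
    then have "2 * c * (1 + 2 * c) = 0" by (simp add: algebra_simps)
    moreover have "1 + 2 * c \<noteq> 0"
      using odd_not_even_in_root_ring[OF K root_ring_uminus[OF K(2) c], of 1]
      by (auto simp: add_eq_0_iff)
    ultimately show ?thesis by simp
  next
    case False
    define g where "g = 1 + 4 * c"
    have g: "g \<in> root_ring K"
      unfolding g_def using root_ring_of_nat[of 4 K] by (auto intro!: root_ring_intros c)
    \<comment> \<open>Summing g^i - 1 = (g - 1)(1 + ... + g^(i-1)) over \<open>i < l\<close>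
      rewrites the cofactor as l + (g - 1)V.\<close>
    define V where "V = (\<Sum>i<l. \<Sum>j<i. g ^ j)"
    have V: "V \<in> root_ring K" unfolding V_def by (intro root_ring_intros g)
    have "(g - 1) * V = (\<Sum>i<l. g ^ i - 1)"
      unfolding V_def by (simp add: sum_distrib_left power_diff_1_eq)
    then have "(\<Sum>i<l. g ^ i) = of_nat l + 4 * c * V"
      by (simp add: sum_subtractf g_def)
    moreover have "of_nat l + 4 * c * V \<noteq> 0"
    proof
      assume "of_nat l + 4 * c * V = 0"
      then have "2 * (- (of_nat 2 * c * V)) = of_nat l"
        by (simp add: add_eq_0_iff algebra_simps)
      moreover have "- (of_nat 2 * c * V) \<in> root_ring K"
        by (intro root_ring_uminus root_ring_intros c V K)
      ultimately show False using odd_not_even_in_root_ring[OF K] False by blast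
    qed
    moreover have "(g - 1) * (\<Sum>i<l. g ^ i) = 0"
      using less.prems(3) by (simp only: power_diff_1_eq[symmetric] g_def) simp
    ultimately show ?thesis by (simp add: g_def)
  qed
qed

section \<open>The eigenvalue equation\<close>

text \<open>For z = exp(it) this is 1 + 2 cos t, the eigenvalue of a path in which each vertex is
  also adjacent to itself.\<close>

definition path_eigenvalue :: "complex \<Rightarrow> complex" where
  "path_eigenvalue z = 1 + z + inverse z"

lemma path_eigenvalue_cube:
  assumes "z \<noteq> 0"
  shows "z ^ 3 - 1 = z * (z - 1) * path_eigenvalue z"
  using assms by (simp add: path_eigenvalue_def field_simps power3_eq_cube)

lemma path_eigenvalue_eq_1:
  assumes "z \<noteq> 0" and "path_eigenvalue z = 1"
  shows "z ^ 2 = -1"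
proof -
  have "z * z + 1 = z * (path_eigenvalue z - 1)"
    using assms(1) by (simp add: path_eigenvalue_def field_simps)
  then show ?thesis using assms(2) by (simp add: power2_eq_square eq_neg_iff_add_eq_0)
qed

text \<open>The factors z^2 + z + 1 and z^2 - z + 1 of z^6 - 1 are z times the eigenvalue and z
  times the eigenvalue minus 2.\<close>

lemma path_eigenvalue_sixth_root:
  assumes "z ^ 6 = 1" and "z ^ 2 \<noteq> 1"
  shows "path_eigenvalue z \<in> {0, 2}"
proof -
  have z: "z \<noteq> 0" using assms by auto
  have "(z ^ 2 - 1) * ((z * path_eigenvalue z) * (z * (path_eigenvalue z - 2))) = z ^ 6 - 1"
    using z by (simp add: path_eigenvalue_def field_simps eval_nat_numeral)
  then show ?thesis using assms z by auto
qed

lemma odd_power_minus_one: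
  fixes z :: complex
  assumes "z ^ 2 = -1" and "z ^ (2 * k) = 1"
  shows "even k"
  using assms by (cases "even k") (auto simp: power_mult)

text \<open>\<open>z\<close> is a power of \<open>z ^ 3\<close>, which makes \<open>path_eigenvalue z\<close> a unit.\<close>

lemma root_minus_one_multiple_of_cube:
  assumes "z ^ (2 * k) = 1" and "k > 0" and "\<not> 3 dvd k" and "2 * k dvd K"
  obtains w where "w \<in> root_ring K" and "z - 1 = (z ^ 3 - 1) * w"
proof -
  have "coprime 3 (2 * k)"
  proof -
    have "prime (3::nat)" by simp
    moreover have "\<not> 3 dvd 2 * k" using assms(3) by presburger
    ultimately show ?thesis by (rule prime_imp_coprime)
  qed
  from cong_solve_coprime_nat[OF this] obtain j where "[3 * j = 1] (mod 2 * k)"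
    by auto
  then have j: "(3 * j) mod (2 * k) = 1 mod (2 * k)" by (simp add: cong_def)
  have red: "z ^ e = z ^ (e mod (2 * k))" for e
  proof -
    have "z ^ e = z ^ (2 * k * (e div (2 * k)) + e mod (2 * k))" by simp
    also have "\<dots> = z ^ (e mod (2 * k))"
      by (simp only: power_add power_mult[of z "2 * k"] assms(1)) simp
    finally show ?thesis .
  qed
  have "z ^ (3 * j) = z" using red[of "3 * j"] red[of 1] j by simp
  then have "z - 1 = (z ^ 3) ^ j - 1" by (simp add: power_mult)
  also have "\<dots> = (z ^ 3 - 1) * (\<Sum>i<j. (z ^ 3) ^ i)" by (rule power_diff_1_eq)
  finally have eq: "z - 1 = (z ^ 3 - 1) * (\<Sum>i<j. (z ^ 3) ^ i)" .
  have "z ^ K = 1" using assms(1,4) by (auto simp: power_mult elim!: dvdE)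
  then have "z \<in> root_ring K" by (rule root_ring_root)
  then show thesis by (intro that[OF _ eq] root_ring_intros)
qed

text \<open>\<open>M\<close> and \<open>N\<close> stand for m + 1 and n + 1. Roots with square 1 are
  excluded because their sine vectors vanish.\<close>

locale eigenvalue_equation =
  fixes M N :: nat and \<zeta> \<eta> :: complex
  assumes M_pos: "M > 0" and N_pos: "N > 0"
    and \<zeta>_root: "\<zeta> ^ (2 * M) = 1" and \<eta>_root: "\<eta> ^ (2 * N) = 1"
    and \<zeta>_sq: "\<zeta> ^ 2 \<noteq> 1" and \<eta>_sq: "\<eta> ^ 2 \<noteq> 1"
    and eigen: "path_eigenvalue \<zeta> * path_eigenvalue \<eta> = 2"
begin

text \<open>A common exponent for \<zeta> and \<eta>; it is even, so that -1 is a
  \<open>K\<close>-th root of unity too.\<close>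

definition K where "K = 2 * M * N"

lemma K_pos: "K > 0" and K_even: "even K"
  using M_pos N_pos by (simp_all add: K_def)

lemma nonzero: "\<zeta> \<noteq> 0" "\<eta> \<noteq> 0"
  using \<zeta>_root \<eta>_root M_pos N_pos by (auto simp: power_0_left)

lemma roots_in_ring:
  "\<zeta> \<in> root_ring K" "\<eta> \<in> root_ring K" "inverse \<eta> \<in> root_ring K"
proof -
  have "K = 2 * M * N" "K = 2 * N * M" by (simp_all add: K_def)
  then have "\<zeta> ^ K = 1" "\<eta> ^ K = 1"
    by (metis \<zeta>_root power_mult power_one, metis \<eta>_root power_mult power_one)
  then show "\<zeta> \<in> root_ring K" "\<eta> \<in> root_ring K" "inverse \<eta> \<in> root_ring K"
    by (auto intro!: root_ring_root simp: power_inverse)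
qed

lemma three_dvd: "3 dvd M \<or> 3 dvd N"
proof (rule ccontr)
  assume *: "\<not> ?thesis"
  have "2 * M dvd K" "2 * N dvd K" by (simp_all add: K_def)
  then obtain v w where v: "v \<in> root_ring K" "\<zeta> - 1 = (\<zeta> ^ 3 - 1) * v"
    and w: "w \<in> root_ring K" "\<eta> - 1 = (\<eta> ^ 3 - 1) * w"
    using * root_minus_one_multiple_of_cube[OF \<zeta>_root M_pos, of K]
      root_minus_one_multiple_of_cube[OF \<eta>_root N_pos, of K] by metis
  have "(\<zeta> - 1) * (\<eta> - 1) = ((\<zeta> ^ 3 - 1) * v) * ((\<eta> ^ 3 - 1) * w)" using v w by simp
  \<comment> \<open>Cancelling (\<zeta> - 1)(\<eta> - 1) will exhibit \<zeta>\<eta>vw as the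
    forbidden ring element 1/2.\<close>
  also have "\<dots> = (\<zeta> - 1) * (\<eta> - 1) * ((path_eigenvalue \<zeta> * path_eigenvalue \<eta>) * (\<zeta> * \<eta> * v * w))"
    by (simp only: path_eigenvalue_cube[OF nonzero(1)] path_eigenvalue_cube[OF nonzero(2)] mult_ac)
  finally have "(\<zeta> - 1) * (\<eta> - 1) = (\<zeta> - 1) * (\<eta> - 1) * (2 * (\<zeta> * \<eta> * v * w))"
    by (simp only: eigen)
  moreover have "\<zeta> - 1 \<noteq> 0" "\<eta> - 1 \<noteq> 0" using \<zeta>_sq \<eta>_sq by auto
  ultimately have "2 * (\<zeta> * \<eta> * v * w) = 1" by simp
  moreover have "\<zeta> * \<eta> * v * w \<in> root_ring K"
    by (intro root_ring_intros roots_in_ring v w)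
  ultimately show False using half_notin_root_ring[OF K_pos] by blast
qed

lemma sixth_root_if_odd:
  assumes "odd M"
  shows "\<zeta> ^ 6 = 1"
proof (rule ccontr)
  assume \<zeta>6: "\<zeta> ^ 6 \<noteq> 1"
  define g where "g = \<zeta> ^ 6"
  define P where "P = path_eigenvalue \<zeta>"
  define Q where "Q = path_eigenvalue \<eta>"
  have PQ: "P * Q = 2" using eigen by (simp add: P_def Q_def)
  have Q_ring: "Q \<in> root_ring K"
    unfolding Q_def path_eigenvalue_def by (intro root_ring_intros roots_in_ring)
  have g_ring: "g \<in> root_ring K" unfolding g_def by (intro root_ring_intros roots_in_ring)
  have "g ^ M = (\<zeta> ^ (2 * M)) ^ 3" by (simp add: g_def power_mult[symmetric] mult.commute)
  then have "(g - 1) * (\<Sum>i<M. g ^ i) = 0"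
    using \<zeta>_root by (simp add: power_diff_1_eq[symmetric])
  then have sum0: "(\<Sum>i<M. g ^ i) = 0" using \<zeta>6 by (simp add: g_def)
  define V where "V = (\<Sum>i<M. \<Sum>j<i. g ^ j)"
  have "(g - 1) * V = (\<Sum>i<M. g ^ i - 1)"
    unfolding V_def by (simp add: sum_distrib_left power_diff_1_eq)
  then have MV: "of_nat M = - ((g - 1) * V)" using sum0 by (simp add: sum_subtractf)
  \<comment> \<open>\<open>P'\<close> is the cofactor of \<open>P\<close> in M = -(g - 1)V, because
    g - 1 = \<zeta>(\<zeta> - 1)P(\<zeta>^3 + 1).\<close>
  define P' where "P' = - (\<zeta> * (\<zeta> - 1) * (\<zeta> ^ 3 + 1) * V)"
  have P'_ring: "P' \<in> root_ring K"
    unfolding P'_def V_def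
    by (intro root_ring_intros root_ring_uminus roots_in_ring K_even g_ring)
  have "g - 1 = (\<zeta> ^ 3 - 1) * (\<zeta> ^ 3 + 1)"
    by (simp add: g_def algebra_simps power_add[symmetric])
  then have PP': "of_nat M = P * P'"
    unfolding MV P'_def path_eigenvalue_cube[OF nonzero(1)] P_def by (simp add: mult_ac)
  obtain r where r: "M = 2 * r + 1" using \<open>odd M\<close> by (auto elim: oddE)
  \<comment> \<open>Multiplying M = PP' by Q gives (2r + 1)Q = 2P', that is, Q = 2(P' - rQ).\<close>
  define q where "q = P' - of_nat r * Q"
  have q_ring: "q \<in> root_ring K"
    unfolding q_def by (intro root_ring_intros K_even P'_ring Q_ring)
  have "of_nat M * Q = 2 * P'" using PP' PQ by (metis mult.assoc mult.commute)
  then have Q2: "Q = 2 * q" unfolding q_def r by (simp add: algebra_simps)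
  \<comment> \<open>Divisibility of \<open>Q\<close> by 2 yields \<eta>^3 = 1 + 2t; squaring
    improves this to a congruence modulo 4.\<close>
  define t where "t = \<eta> * (\<eta> - 1) * q"
  have t_ring: "t \<in> root_ring K"
    unfolding t_def by (intro root_ring_intros K_even roots_in_ring q_ring)
  have "\<eta> ^ 3 - 1 = 2 * t"
    using path_eigenvalue_cube[OF nonzero(2)] Q2 by (simp add: t_def Q_def)
  then have "\<eta> ^ 3 = 1 + 2 * t" by (simp add: algebra_simps)
  moreover have "\<eta> ^ 6 = (\<eta> ^ 3) ^ 2" by simp
  ultimately have \<eta>6: "\<eta> ^ 6 = 1 + 4 * (t * (1 + t))"
    by (simp add: power2_eq_square algebra_simps)
  have "(\<eta> ^ 6) ^ N = (\<eta> ^ (2 * N)) ^ 3" by (simp add: power_mult[symmetric] mult.commute)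
  then have "(1 + 4 * (t * (1 + t))) ^ N = 1" using \<eta>_root \<eta>6 by simp
  moreover have "t * (1 + t) \<in> root_ring K" by (intro root_ring_intros t_ring)
  ultimately have "t * (1 + t) = 0"
    by (intro root_of_unity_cong_1_mod_4[OF K_pos K_even _ N_pos])
  then have "\<eta> ^ 6 = 1" using \<eta>6 by simp
  then have "Q \<in> {0, 2}" unfolding Q_def using \<eta>_sq by (rule path_eigenvalue_sixth_root)
  then have "P = 1" using PQ by auto
  then have "\<zeta> ^ 2 = -1" unfolding P_def by (rule path_eigenvalue_eq_1[OF nonzero(1)])
  then have "even M" using \<zeta>_root by (rule odd_power_minus_one)
  then show False using \<open>odd M\<close> by simp
qed

lemma dvd_if_odd:
  assumes "odd M"
  shows "3 dvd M \<and> 2 dvd N"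
proof
  have \<zeta>6: "\<zeta> ^ 6 = 1" using assms by (rule sixth_root_if_odd)
  then have "path_eigenvalue \<zeta> \<in> {0, 2}" using \<zeta>_sq by (rule path_eigenvalue_sixth_root)
  then have "path_eigenvalue \<eta> = 1" using eigen by auto
  then have "\<eta> ^ 2 = -1" by (rule path_eigenvalue_eq_1[OF nonzero(2)])
  then show "2 dvd N" using \<eta>_root by (rule odd_power_minus_one)
  show "3 dvd M"
  proof (rule ccontr)
    assume "\<not> 3 dvd M"
    then have "\<exists>q. M = 3 * q + 1 \<or> M = 3 * q + 2" by presburger
    then obtain q where "M = 3 * q + 1 \<or> M = 3 * q + 2" by blast
    \<comment> \<open>Modulo the relation \<zeta>^6 = 1, either exponent forces \<zeta>^2 =
      1.\<close>
    then have "2 * M = 6 * q + 2 \<or> 2 * M = 6 * q + 4" by auto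
    then have "\<zeta> ^ (2 * M) = \<zeta> ^ 2 \<or> \<zeta> ^ (2 * M) = \<zeta> ^ 4"
      by (elim disjE) (simp_all only: power_add power_mult \<zeta>6 power_one mult_1_left simp_thms)
    then have "\<zeta> ^ 2 = 1 \<or> \<zeta> ^ 4 = 1" using \<zeta>_root by metis
    moreover have "\<zeta> ^ 6 = \<zeta> ^ 4 * \<zeta> ^ 2" by (simp flip: power_add)
    ultimately show False using \<zeta>6 \<zeta>_sq by auto
  qed
qed

lemma eigenvalue_equation_swap: "eigenvalue_equation N M \<eta> \<zeta>"
  using eigenvalue_equation_axioms by (simp add: eigenvalue_equation_def mult.commute)

text \<open>If \<open>M\<close> or \<open>N\<close> is odd, that one decides the case; if both are
  even, \<open>three_dvd\<close> does.\<close>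

lemma dvd_conditions: "2 dvd M \<and> 3 dvd N \<or> 2 dvd N \<and> 3 dvd M"
  using three_dvd dvd_if_odd eigenvalue_equation.dvd_if_odd[OF eigenvalue_equation_swap] by blast

end

section \<open>Boards and sine transforms\<close>

text \<open>Counting i itself as near makes the neighborhood of a square, including the square, a
  product of two one-dimensional ones. The result type varies because both integer boards and
  complex sines are summed.\<close>

definition near :: "nat \<Rightarrow> nat \<Rightarrow> 'a::zero_neq_one" where
  "near i k = of_bool (\<bar>int i - int k\<bar> \<le> 1)"

lemma near_sym: "near i k = near k i"
  by (simp add: near_def abs_minus_commute)

text \<open>Padding with the zeros at 0 and \<open>m + 1\<close> gives the end points the same
  three-term formula as interior points.\<close>

lemma sum_near:
  fixes f :: "nat \<Rightarrow> 'a::comm_ring_1"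
  assumes "f 0 = 0" and "f (m + 1) = 0" and k: "k \<in> {1..m}"
  shows "(\<Sum>i\<in>{1..m}. near i k * f i) = f (k - 1) + f k + f (k + 1)"
proof -
  have "(\<Sum>i\<in>{1..m}. near i k * f i) = (\<Sum>i\<in>{0..m+1}. near i k * f i)"
    using assms by (intro sum.mono_neutral_left) (auto simp: not_less_eq_eq le_Suc_eq)
  also have "\<dots> = (\<Sum>i\<in>{k - 1, k, k + 1}. near i k * f i)"
    using k by (intro sum.mono_neutral_right) (auto simp: near_def)
  also have "\<dots> = f (k - 1) + f k + f (k + 1)"
    using k by (cases k) (auto simp: near_def)
  finally show ?thesis .
qed

text \<open>Adding the square's own number to both sides of the neighbor-sum equation produces the
  factor 2 and a sum that separates the coordinates.\<close>

lemma neighbor_sum_property_iff: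
  "neighbor_sum_property m n x \<longleftrightarrow>
     (\<forall>i\<in>{1..m}. \<forall>j\<in>{1..n}. 2 * x (i, j) = (\<Sum>k\<in>{1..m}. \<Sum>l\<in>{1..n}. near i k * near j l * x (k, l)))"
proof -
  have "2 * x (i, j) = (\<Sum>k\<in>{1..m}. \<Sum>l\<in>{1..n}. near i k * near j l * x (k, l)) \<longleftrightarrow>
        x (i, j) = (\<Sum>t\<in>{t \<in> squares m n. neighbor (i, j) t}. x t)"
    if "i \<in> {1..m}" "j \<in> {1..n}" for i j
  proof -
    have fin: "finite (squares m n)" by (simp add: squares_def)
    have "(\<Sum>k\<in>{1..m}. \<Sum>l\<in>{1..n}. near i k * near j l * x (k, l)) =
          (\<Sum>t\<in>squares m n. near i (fst t) * near j (snd t) * x t)"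
      by (simp add: squares_def sum.cartesian_product case_prod_beta)
    also have "\<dots> = (\<Sum>t\<in>insert (i, j) {t \<in> squares m n. neighbor (i, j) t}. x t)"
      using that fin
      by (intro sum.mono_neutral_cong_right) (auto simp: neighbor_def near_def squares_def)
    also have "\<dots> = x (i, j) + (\<Sum>t\<in>{t \<in> squares m n. neighbor (i, j) t}. x t)"
      using fin by (subst sum.insert) (auto simp: neighbor_def)
    finally show ?thesis by auto
  qed
  then show ?thesis by (auto simp: neighbor_sum_property_def squares_def)
qed

text \<open>For z = exp(it), \<open>sine z k\<close> is sin(kt) up to the constant factor 2
  sqrt(-1).\<close>

definition sine :: "complex \<Rightarrow> nat \<Rightarrow> complex" where
  "sine z i = z ^ i - inverse z ^ i"

lemma sum_near_sine:
  assumes "z ^ (2 * (m + 1)) = 1" and "k \<in> {1..m}"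
  shows "(\<Sum>i\<in>{1..m}. near i k * sine z i) = path_eigenvalue z * sine z k"
proof -
  have z: "z \<noteq> 0" using assms(1) by auto
  \<comment> \<open>\<open>z ^ (m + 1)\<close> is its own inverse, which is the boundary condition
    at \<open>m + 1\<close>.\<close>
  have "z ^ (m + 1) * z ^ (m + 1) = 1" using assms(1) by (simp only: mult_2 power_add)
  then have "inverse z ^ (m + 1) = z ^ (m + 1)" by (metis inverse_unique power_inverse)
  then have "sine z (m + 1) = 0" by (simp add: sine_def)
  then have "(\<Sum>i\<in>{1..m}. near i k * sine z i) = sine z (k - 1) + sine z k + sine z (k + 1)"
    using assms(2) by (intro sum_near) (simp_all add: sine_def)
  also have "\<dots> = path_eigenvalue z * sine z k"
  proof -
    obtain h where "k = Suc h" using assms(2) by (cases k) auto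
    then show ?thesis using z by (simp add: sine_def path_eigenvalue_def field_simps)
  qed
  finally show ?thesis .
qed

text \<open>Multiplied by \<open>z\<^bsup>m+1\<^esup>\<close>, the transform becomes a polynomial in \<open>z\<close> of degree less than the
  number \<open>2(m+1)\<close> of its roots.\<close>

lemma sine_transform_inj:
  fixes c :: "nat \<Rightarrow> complex"
  assumes "\<And>z. z ^ (2 * (m + 1)) = 1 \<Longrightarrow> (\<Sum>i\<in>{1..m}. c i * sine z i) = 0"
    and k: "k \<in> {1..m}"
  shows "c k = 0"
proof -
  define p where "p = (\<Sum>i\<in>{1..m}. monom (c i) (m + 1 + i) - monom (c i) (m + 1 - i))"
  have "poly p z = 0" if z: "z ^ (2 * (m + 1)) = 1" for z
  proof -
    have nz: "z \<noteq> 0" using z by auto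
    have "poly p z = (\<Sum>i\<in>{1..m}. z ^ (m + 1) * (c i * sine z i))"
      unfolding p_def poly_sum
    proof (rule sum.cong)
      fix i assume "i \<in> {1..m}"
      then have "z ^ (m + 1) = z ^ (m + 1 - i) * z ^ i" by (simp flip: power_add)
      then have "z ^ (m + 1 - i) = z ^ (m + 1) * inverse z ^ i"
        using nz by (simp add: field_simps)
      then show "poly (monom (c i) (m + 1 + i) - monom (c i) (m + 1 - i)) z
          = z ^ (m + 1) * (c i * sine z i)"
        by (simp only: poly_diff poly_monom power_add sine_def) (simp add: algebra_simps)
    qed simp
    also have "\<dots> = z ^ (m + 1) * (\<Sum>i\<in>{1..m}. c i * sine z i)"
      by (rule sum_distrib_left[symmetric])
    finally show ?thesis using assms(1)[OF z] by simp
  qed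
  then have sub: "{z. z ^ (2 * (m + 1)) = 1} \<subseteq> {z. poly p z = 0}" by auto
  have "degree p \<le> 2 * m + 1"
    unfolding p_def
    by (intro degree_sum_le degree_diff_le order.trans[OF degree_monom_le]) auto
  have "p = 0"
  proof (rule ccontr)
    assume "p \<noteq> 0"
    have "card {z::complex. z ^ (2 * (m + 1)) = 1} \<le> card {z. poly p z = 0}"
      by (intro card_mono sub poly_roots_finite \<open>p \<noteq> 0\<close>)
    also have "\<dots> \<le> degree p" by (rule card_poly_roots_bound[OF \<open>p \<noteq> 0\<close>])
    also note \<open>degree p \<le> 2 * m + 1\<close>
    finally show False using card_roots_unity_eq[of "2 * (m + 1)"] by simp
  qed
  \<comment> \<open>Each exponent m + 1 - i lies below m + 1, so only the first monomial with i = k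
    contributes.\<close>
  moreover have "coeff p (m + 1 + k) = (\<Sum>i\<in>{1..m}. if i = k then c i else 0)"
    unfolding p_def coeff_sum by (rule sum.cong) auto
  ultimately show ?thesis using k by simp
qed

text \<open>Pairing the board equation with products of sines and exchanging sums lets the
  neighborhood act on the sines, so a non-zero pairing \<open>S\<close> can be cancelled.\<close>

lemma board_gives_eigenvalue_equation:
  assumes "neighbor_sum_property m n x" and "\<not> trivial_board m n x"
  obtains \<zeta> \<eta> where "eigenvalue_equation (m + 1) (n + 1) \<zeta> \<eta>"
proof -
  define y :: "nat \<Rightarrow> nat \<Rightarrow> complex" where "y i j = of_int (x (i, j))" for i j
  define S where "S \<zeta> \<eta> = (\<Sum>i\<in>{1..m}. (\<Sum>j\<in>{1..n}. y i j * sine \<eta> j) * sine \<zeta> i)" for \<zeta> \<eta>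
  have "\<exists>\<zeta> \<eta>. \<zeta> ^ (2 * (m + 1)) = 1 \<and> \<eta> ^ (2 * (n + 1)) = 1 \<and> S \<zeta> \<eta> \<noteq> 0"
  proof (rule ccontr)
    assume *: "\<not> ?thesis"
    have "x (i, j) = 0" if ij: "i \<in> {1..m}" "j \<in> {1..n}" for i j
    proof -
      \<comment> \<open>Injectivity is applied first in \<open>i\<close>, with \<eta> fixed, and
        then in \<open>j\<close>.\<close>
      have "(\<Sum>j\<in>{1..n}. y i j * sine \<eta> j) = 0" if \<eta>: "\<eta> ^ (2 * (n + 1)) = 1" for \<eta>
        using * \<eta> ij(1)
        by (intro sine_transform_inj[of m "\<lambda>i. \<Sum>j\<in>{1..n}. y i j * sine \<eta> j"]) (auto simp: S_def)
      then have "y i j = 0" using ij(2) by (rule sine_transform_inj)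
      then show ?thesis by (simp add: y_def)
    qed
    then show False using assms(2) by (auto simp: trivial_board_def squares_def)
  qed
  then obtain \<zeta> \<eta> where \<zeta>: "\<zeta> ^ (2 * (m + 1)) = 1" and \<eta>: "\<eta> ^ (2 * (n + 1)) = 1"
    and S: "S \<zeta> \<eta> \<noteq> 0" by blast
  have y: "2 * y i j = (\<Sum>k\<in>{1..m}. \<Sum>l\<in>{1..n}. near i k * near j l * y k l)"
    if "i \<in> {1..m}" "j \<in> {1..n}" for i j
  proof -
    have "2 * x (i, j) = (\<Sum>k\<in>{1..m}. \<Sum>l\<in>{1..n}. near i k * near j l * x (k, l))"
      using assms(1) that unfolding neighbor_sum_property_iff by blast
    then have "of_int (2 * x (i, j)) =
        (of_int (\<Sum>k\<in>{1..m}. \<Sum>l\<in>{1..n}. near i k * near j l * x (k, l)) :: complex)" by simp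
    then show ?thesis by (simp add: y_def near_def)
  qed
  have "2 * S \<zeta> \<eta> = (\<Sum>i\<in>{1..m}. \<Sum>j\<in>{1..n}. (2 * y i j) * (sine \<zeta> i * sine \<eta> j))"
    by (simp add: S_def sum_distrib_left sum_distrib_right mult_ac)
  also have "\<dots> = (\<Sum>i\<in>{1..m}. \<Sum>j\<in>{1..n}. \<Sum>k\<in>{1..m}. \<Sum>l\<in>{1..n}.
      y k l * ((near i k * sine \<zeta> i) * (near j l * sine \<eta> j)))"
  proof (intro sum.cong refl)
    fix i j assume "i \<in> {1..m}" "j \<in> {1..n}"
    then show "(2 * y i j) * (sine \<zeta> i * sine \<eta> j) = (\<Sum>k\<in>{1..m}. \<Sum>l\<in>{1..n}.
        y k l * ((near i k * sine \<zeta> i) * (near j l * sine \<eta> j)))"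
      by (simp only: y sum_distrib_left sum_distrib_right mult_ac)
  qed
  \<comment> \<open>The exchanges bring \<open>k\<close> and \<open>l\<close> outermost, so that the
    inner double sum factors.\<close>
  also have "\<dots> = (\<Sum>i\<in>{1..m}. \<Sum>k\<in>{1..m}. \<Sum>j\<in>{1..n}. \<Sum>l\<in>{1..n}.
      y k l * ((near i k * sine \<zeta> i) * (near j l * sine \<eta> j)))"
    by (rule sum.cong[OF refl], rule sum.swap)
  also have "\<dots> = (\<Sum>k\<in>{1..m}. \<Sum>i\<in>{1..m}. \<Sum>l\<in>{1..n}. \<Sum>j\<in>{1..n}.
      y k l * ((near i k * sine \<zeta> i) * (near j l * sine \<eta> j)))"
    by (subst sum.swap, rule sum.cong[OF refl], rule sum.cong[OF refl], rule sum.swap)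
  also have "\<dots> = (\<Sum>k\<in>{1..m}. \<Sum>l\<in>{1..n}. \<Sum>i\<in>{1..m}. \<Sum>j\<in>{1..n}.
      y k l * ((near i k * sine \<zeta> i) * (near j l * sine \<eta> j)))"
    by (rule sum.cong[OF refl], rule sum.swap)
  also have "\<dots> = (\<Sum>k\<in>{1..m}. \<Sum>l\<in>{1..n}.
      y k l * ((\<Sum>i\<in>{1..m}. near i k * sine \<zeta> i) * (\<Sum>j\<in>{1..n}. near j l * sine \<eta> j)))"
    by (intro sum.cong refl, subst sum_product) (simp only: sum_distrib_left)
  also have "\<dots> = (\<Sum>k\<in>{1..m}. \<Sum>l\<in>{1..n}.
      y k l * ((path_eigenvalue \<zeta> * sine \<zeta> k) * (path_eigenvalue \<eta> * sine \<eta> l)))"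
    by (intro sum.cong refl) (simp only: sum_near_sine[OF \<zeta>] sum_near_sine[OF \<eta>])
  also have "\<dots> = path_eigenvalue \<zeta> * path_eigenvalue \<eta> * S \<zeta> \<eta>"
    by (simp add: S_def sum_distrib_left sum_distrib_right mult_ac)
  finally have eigen: "path_eigenvalue \<zeta> * path_eigenvalue \<eta> = 2" using S by simp
  have sine0: "sine z i = 0" if "z ^ 2 = 1" for z i
    using that by (auto simp: sine_def power2_eq_1_iff)
  have "\<zeta> ^ 2 \<noteq> 1" "\<eta> ^ 2 \<noteq> 1" using S by (auto simp: S_def sine0)
  then show thesis using \<zeta> \<eta> eigen by (intro that) (simp add: eigenvalue_equation_def)
qed

section \<open>Explicit boards\<close>

definition quarter_wave :: "nat \<Rightarrow> int" where
  "quarter_wave i = (if i mod 4 = 1 then 1 else if i mod 4 = 3 then -1 else 0)"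

text \<open>This is sin(pi j/3) scaled to integers, just as \<open>quarter_wave i\<close> is sin(pi
  i/2). Their eigenvalues 2 and 1 multiply to the required 2, and they vanish at multiples of 3 and
  2 respectively.\<close>

definition sixth_wave :: "nat \<Rightarrow> int" where
  "sixth_wave j = (if j mod 6 \<in> {1, 2} then 1 else if j mod 6 \<in> {4, 5} then -1 else 0)"

lemma quarter_wave_step: "quarter_wave h + quarter_wave (Suc h) + quarter_wave (Suc (Suc h)) = quarter_wave (Suc h)"
proof -
  have "h mod 4 \<in> {0, 1, 2, 3}" by auto
  then show ?thesis by (auto simp: quarter_wave_def mod_Suc)
qed

lemma sixth_wave_step: "sixth_wave h + sixth_wave (Suc h) + sixth_wave (Suc (Suc h)) = 2 * sixth_wave (Suc h)"
proof -
  have "h mod 6 \<in> {0, 1, 2, 3, 4, 5}" by auto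
  then show ?thesis by (auto simp: sixth_wave_def mod_Suc)
qed

lemma board_exists:
  assumes "m \<ge> 1" and "n \<ge> 1" and "2 dvd (m + 1)" and "3 dvd (n + 1)"
  shows "\<exists>x. neighbor_sum_property m n x \<and> \<not> trivial_board m n x"
proof (intro exI conjI)
  let ?x = "\<lambda>(i, j). quarter_wave i * sixth_wave j"
  have end_q: "quarter_wave (m + 1) = 0"
    using assms(3) unfolding quarter_wave_def by presburger
  have end_s: "sixth_wave (n + 1) = 0"
  proof -
    have "(n + 1) mod 6 = 0 \<or> (n + 1) mod 6 = 3" using assms(4) by presburger
    then show ?thesis by (auto simp: sixth_wave_def)
  qed
  have q: "(\<Sum>k\<in>{1..m}. near k i * quarter_wave k) = quarter_wave i" if "i \<in> {1..m}" for i
    using that sum_near[of quarter_wave m i, OF _ end_q that] quarter_wave_step[of "i - 1"]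
    by (simp add: quarter_wave_def[of 0])
  have s: "(\<Sum>l\<in>{1..n}. near l j * sixth_wave l) = 2 * sixth_wave j" if "j \<in> {1..n}" for j
    using that sum_near[of sixth_wave n j, OF _ end_s that] sixth_wave_step[of "j - 1"]
    by (simp add: sixth_wave_def[of 0])
  show "neighbor_sum_property m n ?x"
    unfolding neighbor_sum_property_iff
  proof (intro ballI)
    fix i j assume ij: "i \<in> {1..m}" "j \<in> {1..n}"
    have "(\<Sum>k\<in>{1..m}. \<Sum>l\<in>{1..n}. near i k * near j l * ?x (k, l))
        = (\<Sum>k\<in>{1..m}. near k i * quarter_wave k) * (\<Sum>l\<in>{1..n}. near l j * sixth_wave l)"
      by (simp add: sum_product near_sym[of i] near_sym[of j] mult_ac)
    then show "2 * ?x (i, j) = (\<Sum>k\<in>{1..m}. \<Sum>l\<in>{1..n}. near i k * near j l * ?x (k, l))"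
      using q[OF ij(1)] s[OF ij(2)] by simp
  qed
  have "?x (1, 1) = 1" by (simp add: quarter_wave_def sixth_wave_def)
  then show "\<not> trivial_board m n ?x"
    using assms(1,2) unfolding trivial_board_def squares_def by force
qed

lemma board_swap:
  assumes "neighbor_sum_property m n x" and "\<not> trivial_board m n x"
  shows "neighbor_sum_property n m (x \<circ> prod.swap) \<and> \<not> trivial_board n m (x \<circ> prod.swap)"
proof
  show "neighbor_sum_property n m (x \<circ> prod.swap)"
    unfolding neighbor_sum_property_iff
  proof (intro ballI)
    fix i j assume "i \<in> {1..n}" "j \<in> {1..m}"
    then have "2 * x (j, i) = (\<Sum>k\<in>{1..m}. \<Sum>l\<in>{1..n}. near j k * near i l * x (k, l))"
      using assms(1) unfolding neighbor_sum_property_iff by blast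
    also have "\<dots> = (\<Sum>l\<in>{1..n}. \<Sum>k\<in>{1..m}. near i l * near j k * x (k, l))"
      by (subst sum.swap) (simp only: mult_ac)
    finally show "2 * (x \<circ> prod.swap) (i, j) =
        (\<Sum>k\<in>{1..n}. \<Sum>l\<in>{1..m}. near i k * near j l * (x \<circ> prod.swap) (k, l))"
      by simp
  qed
  show "\<not> trivial_board n m (x \<circ> prod.swap)"
    using assms(2) by (auto simp: trivial_board_def squares_def)
qed

text \<open>Transposing a board exchanges \<open>m\<close> and \<open>n\<close>, so the divisibility
  condition is stated up to this exchange.\<close>

theorem theorem11:
  fixes m n :: nat
  assumes "m \<ge> 2" and "n \<ge> 2"
  shows "(\<exists>x :: nat \<times> nat \<Rightarrow> int. neighbor_sum_property m n x \<and> \<not> trivial_board m n x) \<longleftrightarrow>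
         (2 dvd (m + 1) \<and> 3 dvd (n + 1)) \<or> (2 dvd (n + 1) \<and> 3 dvd (m + 1))"
proof
  assume "\<exists>x. neighbor_sum_property m n x \<and> \<not> trivial_board m n x"
  then obtain \<zeta> \<eta> where "eigenvalue_equation (m + 1) (n + 1) \<zeta> \<eta>"
    using board_gives_eigenvalue_equation by blast
  then show "(2 dvd (m + 1) \<and> 3 dvd (n + 1)) \<or> (2 dvd (n + 1) \<and> 3 dvd (m + 1))"
    by (rule eigenvalue_equation.dvd_conditions)
next
  assume "(2 dvd (m + 1) \<and> 3 dvd (n + 1)) \<or> (2 dvd (n + 1) \<and> 3 dvd (m + 1))"
  then show "\<exists>x. neighbor_sum_property m n x \<and> \<not> trivial_board m n x"
    using assms board_exists[of m n] board_exists[of n m] board_swap[of n m] by fastforce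
qed

end
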